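(* Let $\lambda/\mu$ be a skew Young diagram having exactly one corner. Then for every integer $w>|\lambda/\mu|$, $$S_w(\lambda/\mu)=Q_{w-|\lambda/\mu|}\bigl(\varphi(\lambda/\mu)\bigr).$$
   Context: For partitions $\mu\subset\lambda=(\lambda_1,\dots,\lambda_h)$ (with $\mu_i=0$ beyond the length of $\mu$), $D(\lambda/\mu)=\{(i,j)\in\mathbb{Z}^2: 1\le i\le h,\ \mu_i<j\le\lambda_i\}$ and $|\lambda/\mu|=|D(\lambda/\mu)|$. A corner is an $(i,j)\in D(\lambda/\mu)$ with $(i,j+1),(i+1,j)\notin D(\lambda/\mu)$. A Young tableau of shape $\lambda/\mu$ is a filling $(k_{i,j})$ of $D(\lambda/\mu)$ by positive integers; its weight is the sum of its entries; it is admissible if $k_{i,j}\ge2$ at every corner; it is semi-standard if $k_{i,j}<k_{i+1,j}$ and $k_{i,j}\le k_{i,j+1}$ whenever both sides are defined. For an admissible tableau $\boldsymbol{k}=(k_{i,j})$ the Schur multiple zeta value is $\zeta(\boldsymbol{k})=\sum_{(m_{i,j})}\prod_{(i,j)\in D(\lambda/\mu)}m_{i,j}^{-k_{i,j}}$, summed over semi-standard tableaux $(m_{i,j})$ of shape $\lambda/\mu$, and $S_w(\lambda/\mu)$ is the sum of $\zeta(\boldsymbol{k})$ over all admissible tableaux $\boldsymbol{k}$ of shape $\lambda/\mu$ and weight $w$. $\mathfrak{H}^1=\mathbb{Q}\langle z_k\mid k\ge1\rangle$ is the non-commutative polynomial ring. For a word $z_{k_1}\cdots z_{k_d}$ and $l\ge0$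 set $$Q_l(z_{k_1}\cdots z_{k_d})=\sum_{\substack{w_1,\dots,w_{d-1}\ge1,\ w_d\ge2\\ w_1+\cdots+w_d=k_1+\cdots+k_d+l}}\binom{w_1-1}{k_1-1}\cdots\binom{w_{d-1}-1}{k_{d-1}-1}\binom{w_d-2}{k_d-1}\,\zeta(w_1,\dots,w_d),$$ where $\zeta(w_1,\dots,w_d)=\sum_{0<m_1<\cdots<m_d}m_1^{-w_1}\cdots m_d^{-w_d}$ (and $Q_l$ of the empty word is $1$ if $l=0$, else $0$); extend $\mathbb{Q}$-linearly to $Q_l:\mathfrak{H}^1\to\mathbb{R}$. A semi-standard decomposition of $D(\lambda/\mu)$ is a tuple $(D_1,\dots,D_r)$ of non-empty pairwise disjoint subsets with union $D(\lambda/\mu)$ such that, setting $t_{ij}=a$ for $(i,j)\in D_a$, the tableau $(t_{ij})$ is semi-standard. Let $\mathrm{SSD}(\lambda/\mu)$ be the set of all of them, and $$\varphi(\lambda/\mu)=\sum_{(D_1,\dots,D_r)\in\mathrm{SSD}(\lambda/\mu)}z_{|D_1|}\cdots z_{|D_r|}\in\mathfrak{H}^1.$$ *)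

theory Defs
  imports
    "HOL-Analysis.Infinite_Sum"
    "HOL-Library.FuncSet"
    "HOL-Library.Disjoint_Sets"
    "HOL-Library.Poly_Mapping"
begin

section \<open>Skew Young diagrams and tableaux\<close>

text \<open>A partition is the list of its parts, so \<open>part p i\<close> is the \<open>i\<close>-th part with \<open>i\<close> starting at 1,
  extended by 0 beyond the length.\<close>

definition is_partition :: "nat list \<Rightarrow> bool" where
  "is_partition p \<longleftrightarrow> sorted_wrt (\<ge>) p \<and> (\<forall>x\<in>set p. 0 < x)"

definition part :: "nat list \<Rightarrow> nat \<Rightarrow> nat" where
  "part p i = (if 1 \<le> i \<and> i \<le> length p then p ! (i - 1) else 0)"

definition skew_shape :: "nat list \<Rightarrow> nat list \<Rightarrow> bool" where
  "skew_shape la mu \<longleftrightarrow> is_partition la \<and> is_partition mu \<and> (\<forall>i. part mu i \<le> part la i)"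

text \<open>Cells have positive coordinates, so natural numbers suffice; \<open>i\<close> is the row and \<open>j\<close> the column.\<close>

definition diagram :: "nat list \<Rightarrow> nat list \<Rightarrow> (nat \<times> nat) set" where
  "diagram la mu = {(i, j). 1 \<le> i \<and> i \<le> length la \<and> part mu i < j \<and> j \<le> part la i}"

definition corners :: "(nat \<times> nat) set \<Rightarrow> (nat \<times> nat) set" where
  "corners D = {(i, j) \<in> D. (i, j + 1) \<notin> D \<and> (i + 1, j) \<notin> D}"

text \<open>Fillings are extensional functions on the diagram, so that distinct elements of this set are
  distinct fillings.\<close>

definition tableaux :: "(nat \<times> nat) set \<Rightarrow> (nat \<times> nat \<Rightarrow> nat) set" where
  "tableaux D = D \<rightarrow>\<^sub>E {1..}"

definition weight :: "(nat \<times> nat) set \<Rightarrow> (nat \<times> nat \<Rightarrow> nat) \<Rightarrow> nat" where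
  "weight D k = (\<Sum>c\<in>D. k c)"

definition admissible :: "(nat \<times> nat) set \<Rightarrow> (nat \<times> nat \<Rightarrow> nat) \<Rightarrow> bool" where
  "admissible D k \<longleftrightarrow> (\<forall>c\<in>corners D. 2 \<le> k c)"

definition semi_standard :: "(nat \<times> nat) set \<Rightarrow> (nat \<times> nat \<Rightarrow> nat) \<Rightarrow> bool" where
  "semi_standard D m \<longleftrightarrow>
     (\<forall>i j. (i, j) \<in> D \<and> (i + 1, j) \<in> D \<longrightarrow> m (i, j) < m (i + 1, j)) \<and>
     (\<forall>i j. (i, j) \<in> D \<and> (i, j + 1) \<in> D \<longrightarrow> m (i, j) \<le> m (i, j + 1))"

text \<open>The series has non-negative terms and converges for admissible \<open>k\<close>, which is the only
  case in which it is used; the unordered sum is therefore its usual value.\<close>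

definition schur_mzv :: "(nat \<times> nat) set \<Rightarrow> (nat \<times> nat \<Rightarrow> nat) \<Rightarrow> real" where
  "schur_mzv D k =
     (\<Sum>\<^sub>\<infinity>m \<in> {m \<in> tableaux D. semi_standard D m}. \<Prod>c\<in>D. 1 / real (m c) ^ k c)"

definition schur_sum :: "nat \<Rightarrow> nat list \<Rightarrow> nat list \<Rightarrow> real" where
  "schur_sum w la mu =
     (let D = diagram la mu
      in \<Sum>k \<in> {k \<in> tableaux D. admissible D k \<and> weight D k = w}. schur_mzv D k)"


section \<open>The non-commutative polynomial ring\<close>

text \<open>The ring is the monoid algebra, over the rationals, of the free monoid on the letters
  \<open>z\<^sub>k\<close>, \<open>k \<ge> 1\<close>; a word is the list of its indices. The monoid is written
  additively because the product of \<^theory>\<open>HOL-Library.Poly_Mapping\<close> is the convolution with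
  respect to \<open>+\<close> on the exponents.\<close>

typedef zword = "{ks :: nat list. \<forall>k\<in>set ks. 1 \<le> k}"
  morphisms indices Word
  by (rule exI[of _ "[]"]) simp

setup_lifting type_definition_zword

instantiation zword :: monoid_add
begin

lift_definition zero_zword :: zword is "[]" by simp

lift_definition plus_zword :: "zword \<Rightarrow> zword \<Rightarrow> zword" is "(@)" by auto

instance by standard (transfer; simp)+

end

type_synonym H1 = "zword \<Rightarrow>\<^sub>0 rat"

text \<open>Unspecified for \<open>k = 0\<close>, where \<open>[k]\<close> is not in the domain of \<open>Word\<close>.\<close>

definition gen_z :: "nat \<Rightarrow> H1" where
  "gen_z k = Poly_Mapping.single (Word [k]) 1"


section \<open>The maps \<open>Q\<^sub>l\<close>\<close>

definition mzv :: "nat list \<Rightarrow> real" where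
  "mzv ws =
     (\<Sum>\<^sub>\<infinity>ms \<in> {ms. length ms = length ws \<and> sorted_wrt (<) ms \<and> (\<forall>m\<in>set ms. 0 < m)}.
        \<Prod>a<length ws. 1 / real (ms ! a) ^ (ws ! a))"

text \<open>The index \<open>a\<close> runs from 0, so the last index \<open>d\<close> of the usual notation is
  \<open>length ks - 1\<close>.\<close>

definition Q_word :: "nat \<Rightarrow> nat list \<Rightarrow> real" where
  "Q_word l ks =
     (if ks = [] then (if l = 0 then 1 else 0)
      else let d = length ks in
        \<Sum>ws \<in> {ws. length ws = d \<and> (\<forall>a<d - 1. 1 \<le> ws ! a) \<and> 2 \<le> ws ! (d - 1) \<and>
                   sum_list ws = sum_list ks + l}.
          (\<Prod>a<d - 1. real ((ws ! a - 1) choose (ks ! a - 1))) *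
          real ((ws ! (d - 1) - 2) choose (ks ! (d - 1) - 1)) * mzv ws)"

definition Q_map :: "nat \<Rightarrow> H1 \<Rightarrow> real" where
  "Q_map l p = (\<Sum>u \<in> Poly_Mapping.keys p. of_rat (Poly_Mapping.lookup p u) * Q_word l (indices u))"


section \<open>Semi-standard decompositions\<close>

text \<open>The tuple \<open>(D\<^sub>1, \<dots>, D\<^sub>r)\<close> is a list, so \<open>D\<^sub>a\<close> is \<open>Ds ! (a - 1)\<close>.\<close>

definition decomposition_tableau :: "(nat \<times> nat) set list \<Rightarrow> nat \<times> nat \<Rightarrow> nat" where
  "decomposition_tableau Ds =
     (\<lambda>c\<in>\<Union>(set Ds). THE a. a \<in> {1..length Ds} \<and> c \<in> Ds ! (a - 1))"

definition SSD :: "(nat \<times> nat) set \<Rightarrow> (nat \<times> nat) set list set" where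
  "SSD D = {Ds. (\<forall>E\<in>set Ds. E \<noteq> {}) \<and>
                disjoint_family_on (\<lambda>a. Ds ! (a - 1)) {1..length Ds} \<and>
                \<Union>(set Ds) = D \<and>
                semi_standard D (decomposition_tableau Ds)}"

definition \<phi> :: "nat list \<Rightarrow> nat list \<Rightarrow> H1" where
  "\<phi> la mu = (\<Sum>Ds \<in> SSD (diagram la mu). prod_list (map (\<lambda>E. gen_z (card E)) Ds))"

end

theory Submission
  imports Defs "HOL-Analysis.Summation_Tests"
begin

text \<open>
  A semi-standard tableau \<open>m\<close> is determined by its level sets, which form a semi-standard
  decomposition \<open>(D\<^sub>1, \<dots>, D\<^sub>r)\<close>, and by its values \<open>m\<^sub>1 < \<dots> < m\<^sub>r\<close> on them. Its term in
  \<open>\<zeta>(k)\<close> depends on \<open>k\<close> only through the sums \<open>w\<^sub>a\<close> of \<open>k\<close> over the \<open>D\<^sub>a\<close>. Every cell is joined to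
  the unique corner by a path of steps to the right or down, so the corner lies in \<open>D\<^sub>r\<close>; hence the
  number of admissible \<open>k\<close> with given \<open>w\<^sub>1, \<dots>, w\<^sub>r\<close> is the product of binomial coefficients in
  the definition of \<open>Q\<^sub>l\<close>. Absolute convergence justifies the rearrangement.
\<close>

section \<open>Convergence\<close>

text \<open>Any finite set of functions lies in a box over finitely many values, and the sum over a
  box factors into finite sums, each at most \<open>infsum g X\<close>.\<close>

lemma summable_on_prod_PiE_nonneg:
  fixes g :: "'b \<Rightarrow> real"
  assumes "finite I" and nn: "\<And>x. x \<in> X \<Longrightarrow> 0 \<le> g x" and s: "g summable_on X"
  shows "(\<lambda>m. \<Prod>i\<in>I. g (m i)) summable_on (I \<rightarrow>\<^sub>E X)"
proof (rule nonneg_bdd_above_summable_on)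
  show "0 \<le> (\<Prod>i\<in>I. g (m i))" if "m \<in> I \<rightarrow>\<^sub>E X" for m
    using that by (intro prod_nonneg) (auto intro: nn)
  show "bdd_above (sum (\<lambda>m. \<Prod>i\<in>I. g (m i)) ` {F. F \<subseteq> I \<rightarrow>\<^sub>E X \<and> finite F})"
  proof (rule bdd_aboveI2)
    fix F assume "F \<in> {F. F \<subseteq> I \<rightarrow>\<^sub>E X \<and> finite F}"
    then have F: "F \<subseteq> I \<rightarrow>\<^sub>E X" "finite F" by auto
    define Y where "Y = (\<Union>m\<in>F. m ` I)"
    have Y: "finite Y" "Y \<subseteq> X" using F assms(1) by (auto simp: Y_def)
    have FY: "F \<subseteq> I \<rightarrow>\<^sub>E Y"
    proof
      fix m assume m: "m \<in> F"
      then have "m \<in> I \<rightarrow>\<^sub>E X" using F by auto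
      then show "m \<in> I \<rightarrow>\<^sub>E Y" using m by (auto simp: Y_def PiE_iff)
    qed
    have "(\<Sum>m\<in>F. \<Prod>i\<in>I. g (m i)) \<le> (\<Sum>m\<in>I \<rightarrow>\<^sub>E Y. \<Prod>i\<in>I. g (m i))"
    proof (rule sum_mono2)
      show "finite (I \<rightarrow>\<^sub>E Y)" using assms(1) Y by (simp add: finite_PiE)
      show "0 \<le> (\<Prod>i\<in>I. g (m i))" if "m \<in> (I \<rightarrow>\<^sub>E Y) - F" for m
        using that Y by (intro prod_nonneg) (auto intro!: nn)
    qed (rule FY)
    also have "\<dots> = (\<Prod>i\<in>I. \<Sum>x\<in>Y. g x)"
      using prod_sum_PiE[OF assms(1), of "\<lambda>_. Y" "\<lambda>_. g"] Y by simp
    also have "\<dots> \<le> (\<Prod>i\<in>I. infsum g X)"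
      using Y nn by (intro prod_mono conjI sum_nonneg finite_sum_le_infsum s) auto
    finally show "(\<Sum>m\<in>F. \<Prod>i\<in>I. g (m i)) \<le> (\<Prod>i\<in>I. infsum g X)" .
  qed
qed

text \<open>One of the two factors \<open>1 / m i0\<close> at the maximal index is distributed evenly over all
  indices, which bounds the term by a product of summable powers.\<close>

lemma dominated_product_summable:
  fixes k :: "'a \<Rightarrow> nat" and M :: "('a \<Rightarrow> nat) set"
  assumes "finite I" "i0 \<in> I" "\<And>i. i \<in> I \<Longrightarrow> 1 \<le> k i" "2 \<le> k i0"
    and M: "M \<subseteq> I \<rightarrow>\<^sub>E {1..}" and max: "\<And>m i. m \<in> M \<Longrightarrow> i \<in> I \<Longrightarrow> m i \<le> m i0"
  shows "(\<lambda>m. \<Prod>i\<in>I. 1 / real (m i) ^ k i) summable_on M"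
proof -
  define n where "n = real (card I)"
  have n: "n > 0" using assms(1,2) by (auto simp: n_def card_gt_0_iff)
  \<comment> \<open>The exponent joins the power \<open>- 1\<close> that every index keeps to the
    share \<open>- 1/n\<close> received from the maximal index; being below \<open>- 1\<close>, it
    gives a convergent series.\<close>
  define g where "g = (\<lambda>x. real x powr (- 1 - 1/n))"
  have "summable g" unfolding g_def using n by (simp add: summable_real_powr_iff)
  then have "g summable_on UNIV"
    by (intro norm_summable_imp_summable_on) (simp add: g_def)
  then have "g summable_on {1..}" by (rule summable_on_subset_banach) simp
  then have "(\<lambda>m. \<Prod>i\<in>I. g (m i)) summable_on (I \<rightarrow>\<^sub>E {1..})"
    by (intro summable_on_prod_PiE_nonneg assms(1)) (auto simp: g_def)
  then have "(\<lambda>m. \<Prod>i\<in>I. g (m i)) summable_on M"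
    by (rule summable_on_subset_banach) (rule M)
  then show ?thesis
  proof (rule summable_on_comparison_test)
    fix m assume m: "m \<in> M"
    have pos: "0 < m i" if "i \<in> I" for i
    proof -
      have "m i \<in> {1..}" using m M that by (auto simp: PiE_iff)
      then show ?thesis by simp
    qed
    have "(\<Prod>i\<in>I. 1 / real (m i) ^ k i) = (1 / real (m i0) ^ k i0) * (\<Prod>i\<in>I-{i0}. 1 / real (m i) ^ k i)"
      using assms(1,2) by (simp add: prod.remove)
    also have "\<dots> \<le> (1 / real (m i0) ^ 2) * (\<Prod>i\<in>I-{i0}. 1 / real (m i))"
    proof (rule mult_mono)
      show "1 / real (m i0) ^ k i0 \<le> 1 / real (m i0) ^ 2"
        using pos[OF assms(2)] assms(4)
        by (intro divide_left_mono power_increasing mult_pos_pos zero_less_power) auto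
      show "(\<Prod>i\<in>I-{i0}. 1 / real (m i) ^ k i) \<le> (\<Prod>i\<in>I-{i0}. 1 / real (m i))"
      proof (intro prod_mono conjI)
        fix i assume i: "i \<in> I - {i0}"
        then have "0 < m i" "1 \<le> k i" using pos assms(3) by auto
        then have "real (m i) ^ 1 \<le> real (m i) ^ k i"
          by (intro power_increasing) auto
        then show "1 / real (m i) ^ k i \<le> 1 / real (m i)"
          using \<open>0 < m i\<close> by (intro divide_left_mono) auto
      qed simp
    qed (auto intro: prod_nonneg)
    also have "\<dots> = (1 / real (m i0)) * (\<Prod>i\<in>I. 1 / real (m i))"
      using assms(1,2) by (simp add: prod.remove power2_eq_square)
    also have "1 / real (m i0) = (real (m i0) powr (-1/n)) powr n"
      unfolding powr_powr using pos[OF assms(2)] n by (simp add: powr_minus_divide)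
    also have "\<dots> = (\<Prod>i\<in>I. real (m i0) powr (-1/n))"
      using pos[OF assms(2)] by (simp add: n_def powr_realpow)
    \<comment> \<open>The exponent \<open>-1/n\<close> is negative, so replacing \<open>m i0\<close>
      by the smaller \<open>m i\<close> can only increase each factor.\<close>
    also have "\<dots> * (\<Prod>i\<in>I. 1 / real (m i)) \<le> (\<Prod>i\<in>I. real (m i) powr (-1/n)) * (\<Prod>i\<in>I. 1 / real (m i))"
      using max[OF m] pos n by (intro mult_right_mono prod_mono conjI powr_mono2') (auto intro: prod_nonneg)
    also have "\<dots> = (\<Prod>i\<in>I. g (m i))"
      unfolding prod.distrib[symmetric]
    proof (rule prod.cong)
      fix i assume "i \<in> I"
      then have "0 < m i" by (rule pos)
      then show "real (m i) powr (-1/n) * (1 / real (m i)) = g (m i)"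
        by (simp add: g_def powr_diff powr_minus_divide)
    qed simp
    finally show "(\<Prod>i\<in>I. 1 / real (m i) ^ k i) \<le> (\<Prod>i\<in>I. g (m i))" .
  qed (auto intro: prod_nonneg)
qed

text \<open>The index set of the series \<open>mzv\<close>. It depends on the depth only, so series
  with different exponents can be combined termwise.\<close>

definition increasing_seqs :: "nat \<Rightarrow> nat list set" where
  "increasing_seqs r = {ms. length ms = r \<and> sorted_wrt (<) ms \<and> (\<forall>m\<in>set ms. 0 < m)}"

text \<open>The last entry of an increasing sequence is the largest, and its exponent is at least 2,
  so \<open>dominated_product_summable\<close> applies.\<close>

lemma mzv_summable:
  assumes "ws \<noteq> []" "\<And>i. i < length ws \<Longrightarrow> 1 \<le> ws ! i" "2 \<le> ws ! (length ws - 1)"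
  shows "(\<lambda>ms. \<Prod>i<length ws. 1 / real (ms ! i) ^ (ws ! i)) summable_on increasing_seqs (length ws)"
proof -
  \<comment> \<open>\<open>h\<close> reads a list as an extensional function on its
    positions.\<close>
  define h :: "nat list \<Rightarrow> nat \<Rightarrow> nat" where "h = (\<lambda>ms. \<lambda>i\<in>{..<length ws}. ms ! i)"
  have inj: "inj_on h (increasing_seqs (length ws))"
  proof (rule inj_onI)
    fix ms ns assume "ms \<in> increasing_seqs (length ws)" "ns \<in> increasing_seqs (length ws)" "h ms = h ns"
    then have "length ms = length ws" "length ns = length ws" "h ms = h ns"
      by (auto simp: increasing_seqs_def)
    moreover have "ms ! i = ns ! i" if "i < length ws" for i
      using fun_cong[OF \<open>h ms = h ns\<close>, of i] that by (simp add: h_def)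
    ultimately show "ms = ns" by (intro nth_equalityI) auto
  qed
  have "(\<lambda>m. \<Prod>i<length ws. 1 / real (m i) ^ (ws ! i)) summable_on h ` increasing_seqs (length ws)"
  proof (rule dominated_product_summable[where ?i0.0 = "length ws - 1"])
    show "h ` increasing_seqs (length ws) \<subseteq> {..<length ws} \<rightarrow>\<^sub>E {1..}"
      by (intro image_subsetI) (simp add: h_def increasing_seqs_def Suc_le_eq restrict_PiE_iff)
    fix m i assume "m \<in> h ` increasing_seqs (length ws)" "i \<in> {..<length ws}"
    then obtain ms where "m = h ms" "length ms = length ws" "sorted ms" "i < length ws"
      by (auto simp: increasing_seqs_def strict_sorted_iff)
    then show "m i \<le> m (length ws - 1)"
      by (auto simp: h_def intro!: sorted_nth_mono)
  qed (use assms in auto)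
  then have "(\<lambda>m. \<Prod>i<length ws. 1 / real (m i) ^ (ws ! i)) \<circ> h summable_on increasing_seqs (length ws)"
    by (simp add: summable_on_reindex[OF inj])
  then show ?thesis
    by (rule summable_on_cong[THEN iffD1, rotated]) (auto simp: h_def)
qed

section \<open>Fillings with prescribed block sums\<close>

text \<open>Stars and bars: enumerating \<open>E\<close> turns the fillings into lists of length
  \<open>card E\<close> with sum \<open>n\<close>.\<close>

lemma card_PiE_sum_eq:
  assumes "finite E" "E \<noteq> {}"
  shows "card {f \<in> E \<rightarrow>\<^sub>E (UNIV :: nat set). (\<Sum>c\<in>E. f c) = n} = (n + card E - 1) choose (card E - 1)"
proof -
  obtain es where es: "set es = E" "distinct es"
    using finite_distinct_list[OF assms(1)] by blast
  have len: "length es = card E" using es distinct_card by fastforce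
  have "bij_betw (\<lambda>f. map f es) {f \<in> E \<rightarrow>\<^sub>E (UNIV :: nat set). (\<Sum>c\<in>E. f c) = n}
          {l. length l = card E \<and> sum_list l = n}"
  proof (rule bij_betw_imageI)
    show "inj_on (\<lambda>f. map f es) {f \<in> E \<rightarrow>\<^sub>E (UNIV :: nat set). (\<Sum>c\<in>E. f c) = n}"
    proof (rule inj_onI)
      fix f f' assume "f \<in> {f \<in> E \<rightarrow>\<^sub>E (UNIV :: nat set). (\<Sum>c\<in>E. f c) = n}"
        "f' \<in> {f \<in> E \<rightarrow>\<^sub>E (UNIV :: nat set). (\<Sum>c\<in>E. f c) = n}" "map f es = map f' es"
      then show "f = f'" using es by (intro PiE_ext[of f E "\<lambda>_. UNIV"]) auto
    qed
    show "(\<lambda>f. map f es) ` {f \<in> E \<rightarrow>\<^sub>E (UNIV :: nat set). (\<Sum>c\<in>E. f c) = n} =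
        {l. length l = card E \<and> sum_list l = n}" (is "?l = ?r")
    proof (intro equalityI subsetI)
      fix l assume "l \<in> ?l"
      then show "l \<in> ?r" using es by (auto simp: len sum_list_distinct_conv_sum_set)
    next
      fix l assume l: "l \<in> ?r"
      define f where "f = (\<lambda>c\<in>E. the (map_of (zip es l) c))"
      have "map f es = l"
      proof (rule nth_equalityI)
        show "length (map f es) = length l" using l len by simp
        fix i assume "i < length (map f es)"
        then have i: "i < length es" by simp
        then have "map_of (zip es l) (es ! i) = Some (l ! i)"
          using l len es by (intro map_of_zip_nth) auto
        then show "map f es ! i = l ! i" using i es by (auto simp: f_def)
      qed
      moreover have "f \<in> E \<rightarrow>\<^sub>E UNIV" by (simp add: f_def)
      moreover have "(\<Sum>c\<in>E. f c) = n"
        using sum_list_distinct_conv_sum_set[OF es(2), of f] l es \<open>map f es = l\<close> by simp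
      ultimately show "l \<in> ?l" by force
    qed
  qed
  then have "card {f \<in> E \<rightarrow>\<^sub>E (UNIV :: nat set). (\<Sum>c\<in>E. f c) = n} = (n + card E - 1) choose n"
    by (simp add: bij_betw_same_card card_length_sum_list)
  \<comment> \<open>The list count has lower index \<open>n\<close>; positivity of
    \<open>card E\<close> keeps the subtraction exact, so that the complementary index is
    \<open>card E - 1\<close>.\<close>
  moreover have "card E > 0" using assms by (simp add: card_gt_0_iff)
  ultimately show ?thesis
    using binomial_symmetric[of n "n + card E - 1"] by simp
qed

text \<open>With \<open>b\<close> equal to 2 at the corner and 1 elsewhere, these are the admissible
  tableaux of weight \<open>n\<close> on the diagram, and also the possible restrictions to a
  block.\<close>

definition bounded_fillings :: "('a \<Rightarrow> nat) \<Rightarrow> 'a set \<Rightarrow> nat \<Rightarrow> ('a \<Rightarrow> nat) set" where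
  "bounded_fillings b E n = {f \<in> E \<rightarrow>\<^sub>E UNIV. (\<forall>c\<in>E. b c \<le> f c) \<and> (\<Sum>c\<in>E. f c) = n}"

lemma finite_bounded_fillings: "finite E \<Longrightarrow> finite (bounded_fillings b E n)"
proof -
  assume E: "finite E"
  have "bounded_fillings b E n \<subseteq> E \<rightarrow>\<^sub>E {..n}"
    using E by (auto simp: bounded_fillings_def PiE_iff extensional_def intro: member_le_sum)
  then show ?thesis using E by (meson finite_PiE finite_atMost finite_subset)
qed

text \<open>Subtracting \<open>b\<close> reduces to fillings without lower bound. The case
  distinction matters: for \<open>n < sum b E\<close> the truncated subtraction would give 1 instead
  of 0.\<close>

lemma card_bounded_fillings:
  assumes "finite E" "E \<noteq> {}"
  shows "card (bounded_fillings b E n) =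
    (if sum b E \<le> n then (n - sum b E + card E - 1) choose (card E - 1) else 0)"
proof (cases "sum b E \<le> n")
  case True
  have "bij_betw (\<lambda>f. \<lambda>c\<in>E. f c - b c) (bounded_fillings b E n)
      {f \<in> E \<rightarrow>\<^sub>E UNIV. (\<Sum>c\<in>E. f c) = n - sum b E}"
    by (rule bij_betw_byWitness[where f' = "\<lambda>f. \<lambda>c\<in>E. f c + b c"])
      (use True in \<open>auto simp: bounded_fillings_def sum_subtractf_nat sum.distrib
        fun_eq_iff PiE_iff extensional_def\<close>)
  then show ?thesis using True card_PiE_sum_eq[OF assms] by (simp add: bij_betw_same_card)
next
  case False
  then have "bounded_fillings b E n = {}"
    using sum_mono[of E b] by (force simp: bounded_fillings_def)
  then show ?thesis using False by simp
qed

lemma sum_Union_blocks: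
  fixes k :: "'a \<Rightarrow> nat"
  assumes "\<And>i j. i < length Ds \<Longrightarrow> j < length Ds \<Longrightarrow> i \<noteq> j \<Longrightarrow> Ds ! i \<inter> Ds ! j = {}"
    and "finite (\<Union>(set Ds))"
  shows "sum k (\<Union>(set Ds)) = sum_list (map (sum k) Ds)"
proof -
  have U: "\<Union>(set Ds) = (\<Union>i<length Ds. Ds ! i)"
    by (auto simp: set_conv_nth)
  show ?thesis
    unfolding U using assms
    by (subst sum.UNION_disjoint) (auto simp: U sum_list_sum_nth atLeast0LessThan)
qed

text \<open>A filling of a disjoint union amounts to a family of fillings of the blocks, and block
  sums \<open>ws\<close> with \<open>sum_list ws = w\<close> already fix the total.\<close>

lemma bij_betw_bounded_fillings_blocks:
  fixes Ds :: "'a set list"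
  assumes disj: "\<And>i j. i < length Ds \<Longrightarrow> j < length Ds \<Longrightarrow> i \<noteq> j \<Longrightarrow> Ds ! i \<inter> Ds ! j = {}"
    and "finite (\<Union>(set Ds))" "length ws = length Ds" "sum_list ws = w"
  shows "bij_betw (\<lambda>k. \<lambda>i\<in>{..<length Ds}. restrict k (Ds ! i))
    {k \<in> bounded_fillings b (\<Union>(set Ds)) w. map (sum k) Ds = ws}
    (\<Pi>\<^sub>E i\<in>{..<length Ds}. bounded_fillings b (Ds ! i) (ws ! i))"
proof -
  have U: "\<Union>(set Ds) = (\<Union>i<length Ds. Ds ! i)"
    by (auto simp: set_conv_nth)
  note total = sum_Union_blocks[OF disj assms(2)]
  \<comment> \<open>\<open>ix c\<close> is the position of the block containing \<open>c\<close>,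
    unique by disjointness; the inverse map glues block fillings along it.\<close>
  have "\<forall>c\<in>\<Union>(set Ds). \<exists>i. i < length Ds \<and> c \<in> Ds ! i" by (auto simp: U)
  from bchoice[OF this] obtain ix where ix: "\<forall>c\<in>\<Union>(set Ds). ix c < length Ds \<and> c \<in> Ds ! ix c" ..
  have ix_eq: "ix c = i" if "i < length Ds" "c \<in> Ds ! i" for c i
  proof (rule ccontr)
    have c: "c \<in> \<Union>(set Ds)" using that by (auto simp: U)
    assume "ix c \<noteq> i"
    then show False using disj[of "ix c" i] c ix that by blast
  qed
  have in_U: "c \<in> \<Union>(set Ds)" if "i < length Ds" "c \<in> Ds ! i" for c i
    using that by (auto simp: U)
  let ?K = "{k \<in> bounded_fillings b (\<Union>(set Ds)) w. map (sum k) Ds = ws}"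
  let ?P = "\<Pi>\<^sub>E i\<in>{..<length Ds}. bounded_fillings b (Ds ! i) (ws ! i)"
  let ?F = "\<lambda>k. \<lambda>i\<in>{..<length Ds}. restrict k (Ds ! i)"
  let ?G = "\<lambda>f. \<lambda>c\<in>\<Union>(set Ds). f (ix c) c"
  show ?thesis
  proof (rule bij_betw_byWitness[where f' = ?G])
    show "\<forall>k\<in>?K. ?G (?F k) = k"
    proof
      fix k assume "k \<in> ?K"
      then have "k \<in> extensional (\<Union>(set Ds))" by (auto simp: bounded_fillings_def PiE_iff)
      then show "?G (?F k) = k"
        using ix by (auto simp: fun_eq_iff extensional_def)
    qed
    show "\<forall>f\<in>?P. ?F (?G f) = f"
    proof
      fix f assume f: "f \<in> ?P"
      show "?F (?G f) = f"
      proof (rule PiE_ext[OF _ f])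
        show "?F (?G f) i = f i" if i: "i \<in> {..<length Ds}" for i
        proof -
          have "f i \<in> bounded_fillings b (Ds ! i) (ws ! i)" using f i by auto
          then have "f i \<in> extensional (Ds ! i)" by (auto simp: bounded_fillings_def PiE_iff)
          then show ?thesis
            using i in_U ix_eq by (auto simp: fun_eq_iff extensional_def restrict_def)
        qed
        show "?F (?G f) \<in> ?P"
        proof (rule PiE_I)
          fix i assume i: "i \<in> {..<length Ds}"
          have "f i \<in> bounded_fillings b (Ds ! i) (ws ! i)" using f i by auto
          moreover have "restrict (?G f) (Ds ! i) = restrict (f i) (Ds ! i)"
            using i in_U ix_eq by (auto simp: fun_eq_iff restrict_def)
          ultimately show "?F (?G f) i \<in> bounded_fillings b (Ds ! i) (ws ! i)"
            using i by (auto simp: bounded_fillings_def PiE_iff)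
        qed auto
      qed
    qed
    show "?F ` ?K \<subseteq> ?P"
    proof
      fix f assume "f \<in> ?F ` ?K"
      then obtain k where k: "k \<in> ?K" and f: "f = ?F k" by auto
      have "restrict k (Ds ! i) \<in> bounded_fillings b (Ds ! i) (ws ! i)" if "i < length Ds" for i
        using k that by (auto simp: bounded_fillings_def)
      then show "f \<in> ?P" unfolding f by auto
    qed
    show "?G ` ?P \<subseteq> ?K"
    proof
      fix k assume "k \<in> ?G ` ?P"
      then obtain f where f: "f \<in> ?P" and k: "k = ?G f" by auto
      have bf: "f i \<in> bounded_fillings b (Ds ! i) (ws ! i)" if "i < length Ds" for i
        using f that by auto
      have k_eq: "k c = f i c" if "i < length Ds" "c \<in> Ds ! i" for i c
        using in_U[OF that] ix_eq[OF that] by (simp add: k)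
      have "map (sum k) Ds = ws"
      proof (rule nth_equalityI)
        fix i assume "i < length (map (sum k) Ds)"
        then have i: "i < length Ds" by simp
        have "sum k (Ds ! i) = sum (f i) (Ds ! i)"
          using k_eq[OF i] by (rule sum.cong[OF refl])
        then show "map (sum k) Ds ! i = ws ! i"
          using bf[OF i] i by (simp add: bounded_fillings_def)
      qed (simp add: assms)
      moreover have "b c \<le> k c" if "c \<in> \<Union>(set Ds)" for c
      proof -
        have "ix c < length Ds" "c \<in> Ds ! ix c" using ix that by auto
        then show ?thesis using bf[of "ix c"] k_eq[of "ix c" c] by (auto simp: bounded_fillings_def)
      qed
      moreover have "k \<in> \<Union>(set Ds) \<rightarrow>\<^sub>E UNIV" unfolding k by auto
      moreover have "sum k (\<Union>(set Ds)) = w"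
        using total[of k] \<open>map (sum k) Ds = ws\<close> assms(4) by simp
      ultimately show "k \<in> ?K" unfolding bounded_fillings_def by blast
    qed
  qed
qed

lemma finite_lists_sum_eq: "finite {ws :: nat list. length ws = r \<and> sum_list ws = w}"
  by (rule finite_subset[OF _ finite_lists_length_le[of "{..w}" r]]) (auto intro: member_le_sum_list)

text \<open>Group the fillings by their block sums \<open>ws\<close>. The summand is constant on
  each group, whose size is the product of the numbers of block fillings.\<close>

lemma sum_bounded_fillings_blocks:
  fixes Ds :: "'a set list" and g :: "nat \<Rightarrow> nat \<Rightarrow> real"
  assumes disj: "\<And>i j. i < length Ds \<Longrightarrow> j < length Ds \<Longrightarrow> i \<noteq> j \<Longrightarrow> Ds ! i \<inter> Ds ! j = {}"
    and "finite (\<Union>(set Ds))"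
  shows "(\<Sum>k\<in>bounded_fillings b (\<Union>(set Ds)) w. \<Prod>i<length Ds. g i (sum k (Ds ! i))) =
    (\<Sum>ws | length ws = length Ds \<and> sum_list ws = w.
      (\<Prod>i<length Ds. real (card (bounded_fillings b (Ds ! i) (ws ! i)))) * (\<Prod>i<length Ds. g i (ws ! i)))"
proof -
  let ?T = "{ws :: nat list. length ws = length Ds \<and> sum_list ws = w}"
  let ?K = "bounded_fillings b (\<Union>(set Ds)) w"
  note total = sum_Union_blocks[OF disj assms(2)]
  have "finite ?T"
    by (rule finite_lists_sum_eq)
  then have "(\<Sum>k\<in>?K. \<Prod>i<length Ds. g i (sum k (Ds ! i))) =
      (\<Sum>ws\<in>?T. \<Sum>k | k \<in> ?K \<and> map (sum k) Ds = ws. \<Prod>i<length Ds. g i (sum k (Ds ! i)))"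
    using assms(2) by (intro sum.group[symmetric] finite_bounded_fillings)
      (auto simp: bounded_fillings_def total)
  also have "\<dots> = (\<Sum>ws\<in>?T. (\<Prod>i<length Ds. real (card (bounded_fillings b (Ds ! i) (ws ! i)))) *
      (\<Prod>i<length Ds. g i (ws ! i)))"
  proof (rule sum.cong[OF refl])
    fix ws assume ws: "ws \<in> ?T"
    have "(\<Sum>k | k \<in> ?K \<and> map (sum k) Ds = ws. \<Prod>i<length Ds. g i (sum k (Ds ! i))) =
        (\<Sum>k | k \<in> ?K \<and> map (sum k) Ds = ws. \<Prod>i<length Ds. g i (ws ! i))"
      by (intro sum.cong prod.cong) auto
    also have "\<dots> = real (card {k \<in> ?K. map (sum k) Ds = ws}) * (\<Prod>i<length Ds. g i (ws ! i))"
      by simp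
    also have "card {k \<in> ?K. map (sum k) Ds = ws} =
        card (\<Pi>\<^sub>E i\<in>{..<length Ds}. bounded_fillings b (Ds ! i) (ws ! i))"
      using ws by (intro bij_betw_same_card[OF bij_betw_bounded_fillings_blocks] disj assms(2)) auto
    finally show "(\<Sum>k | k \<in> ?K \<and> map (sum k) Ds = ws. \<Prod>i<length Ds. g i (sum k (Ds ! i))) =
        (\<Prod>i<length Ds. real (card (bounded_fillings b (Ds ! i) (ws ! i)))) * (\<Prod>i<length Ds. g i (ws ! i))"
      by (simp add: card_PiE)
  qed
  finally show ?thesis .
qed

section \<open>Tableaux and semi-standard decompositions\<close>

text \<open>From a cell other than \<open>c0\<close> a step right or down stays in \<open>D\<close>
  without lowering the entry; as \<open>D\<close> is finite, the walk ends at
  \<open>c0\<close>.\<close>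

lemma semi_standard_le_corner:
  assumes "finite D" "corners D = {c0}" "semi_standard D t" "c \<in> D"
  shows "t c \<le> t c0"
proof -
  \<comment> \<open>Each step raises \<open>i + j\<close> by one, so the distance of
    \<open>i + j\<close> from the bound \<open>N\<close> serves as induction measure.\<close>
  obtain N where N: "\<And>c. c \<in> D \<Longrightarrow> fst c + snd c \<le> N"
    using assms(1) finite_nat_set_iff_bounded_le[of "(\<lambda>c. fst c + snd c) ` D"] by auto
  show ?thesis using assms(4)
  proof (induction "N - (fst c + snd c)" arbitrary: c rule: less_induct)
    case less
    obtain i j where c: "c = (i, j)" by (cases c)
    consider "(i, j + 1) \<in> D" | "(i + 1, j) \<in> D" | "c \<in> corners D"
      using less.prems by (auto simp: c corners_def)
    then show ?case
    proof cases
      case 1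
      then have "t (i, j) \<le> t (i, j + 1)"
        using assms(3) less.prems by (auto simp: c semi_standard_def)
      also have "\<dots> \<le> t c0" using 1 N[OF 1] by (intro less.hyps) (auto simp: c)
      finally show ?thesis by (simp add: c)
    next
      case 2
      then have "t (i, j) < t (i + 1, j)"
        using assms(3) less.prems by (auto simp: c semi_standard_def)
      also have "\<dots> \<le> t c0" using 2 N[OF 2] by (intro less.hyps) (auto simp: c)
      finally show ?thesis by (simp add: c)
    next
      case 3
      then show ?thesis using assms(2) by simp
    qed
  qed
qed

text \<open>Stated without membership in \<open>SSD\<close>, because it is applied to level sets
  before they are known to form a decomposition. Labels start at 1, list positions at 0.\<close>

lemma decomposition_tableau_disjoint:
  assumes "disjoint_family_on (\<lambda>a. Ds ! (a - 1)) {1..length Ds}" "i < length Ds" "c \<in> Ds ! i"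
  shows "decomposition_tableau Ds c = Suc i"
proof -
  have "c \<in> \<Union>(set Ds)" using nth_mem[OF assms(2)] assms(3) by blast
  moreover have "(THE a. a \<in> {1..length Ds} \<and> c \<in> Ds ! (a - 1)) = Suc i"
  proof (rule the_equality)
    show i: "Suc i \<in> {1..length Ds} \<and> c \<in> Ds ! (Suc i - 1)" using assms by auto
    fix a assume a: "a \<in> {1..length Ds} \<and> c \<in> Ds ! (a - 1)"
    then show "a = Suc i"
      using i assms(1) unfolding disjoint_family_on_def by blast
  qed
  ultimately show ?thesis by (simp add: decomposition_tableau_def)
qed

lemma decomposition_tableau_eq:
  assumes "Ds \<in> SSD D" "i < length Ds" "c \<in> Ds ! i"
  shows "decomposition_tableau Ds c = Suc i"
  using assms by (intro decomposition_tableau_disjoint) (auto simp: SSD_def)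

lemma SSD_obtain_block:
  assumes "Ds \<in> SSD D" "c \<in> D"
  obtains i where "i < length Ds" "c \<in> Ds ! i" "decomposition_tableau Ds c = Suc i"
proof -
  have "c \<in> \<Union>(set Ds)" using assms by (simp add: SSD_def)
  then obtain i where "i < length Ds" "c \<in> Ds ! i" by (auto simp: in_set_conv_nth)
  then show ?thesis using that decomposition_tableau_eq[OF assms(1)] by blast
qed

text \<open>A common cell would carry both labels \<open>Suc i\<close> and
  \<open>Suc j\<close>.\<close>

lemma SSD_blocks_disjoint:
  assumes "Ds \<in> SSD D" "i < length Ds" "j < length Ds" "i \<noteq> j"
  shows "Ds ! i \<inter> Ds ! j = {}"
  using decomposition_tableau_eq[OF assms(1,2)] decomposition_tableau_eq[OF assms(1,3)] assms(4)
  by fastforce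

text \<open>Non-empty disjoint blocks are distinct, so decompositions are among the finitely many
  repetition-free lists of subsets of \<open>D\<close>.\<close>

lemma finite_SSD: "finite D \<Longrightarrow> finite (SSD D)"
proof -
  assume "finite D"
  have "SSD D \<subseteq> {Ds. set Ds \<subseteq> Pow D \<and> distinct Ds}"
  proof
    fix Ds assume Ds: "Ds \<in> SSD D"
    then have "set Ds \<subseteq> Pow D" by (auto simp: SSD_def)
    moreover have "Ds ! i \<noteq> {}" if "i < length Ds" for i using Ds that by (auto simp: SSD_def)
    then have "distinct Ds"
      using SSD_blocks_disjoint[OF Ds] unfolding distinct_conv_nth by (metis inf.idem)
    ultimately show "Ds \<in> {Ds. set Ds \<subseteq> Pow D \<and> distinct Ds}" by simp
  qed
  then show "finite (SSD D)"
    using \<open>finite D\<close> finite_subset_distinct[of "Pow D"] finite_subset by blast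
qed

text \<open>The decomposition tableau is semi-standard, so its label at \<open>c0\<close> is the
  largest; the label \<open>length Ds\<close> does occur, because the last block is
  non-empty.\<close>

lemma corner_in_last_block:
  assumes "finite D" "corners D = {c0}" "Ds \<in> SSD D"
  shows "Ds \<noteq> []" "c0 \<in> Ds ! (length Ds - 1)"
proof -
  have "c0 \<in> corners D" using assms(2) by simp
  then have c0: "c0 \<in> D" by (auto simp: corners_def)
  then show ne: "Ds \<noteq> []" using assms(3) by (auto simp: SSD_def)
  then have "Ds ! (length Ds - 1) \<in> set Ds" by simp
  moreover have "\<forall>E\<in>set Ds. E \<noteq> {}" "\<Union>(set Ds) = D" using assms(3) by (simp_all add: SSD_def)
  ultimately obtain c where c: "c \<in> Ds ! (length Ds - 1)" "c \<in> D" by blast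
  then have "decomposition_tableau Ds c = length Ds"
    using decomposition_tableau_eq[OF assms(3), of "length Ds - 1" c] ne by simp
  moreover obtain i where i: "i < length Ds" "c0 \<in> Ds ! i" "decomposition_tableau Ds c0 = Suc i"
    using SSD_obtain_block[OF assms(3) c0] .
  moreover have "decomposition_tableau Ds c \<le> decomposition_tableau Ds c0"
    using assms(3) c by (intro semi_standard_le_corner[OF assms(1,2)]) (auto simp: SSD_def)
  ultimately have "i = length Ds - 1" by simp
  then show "c0 \<in> Ds ! (length Ds - 1)" using i by simp
qed

section \<open>Tableaux as decompositions with increasing values\<close>

definition combine_values :: "(nat \<times> nat) set \<Rightarrow> (nat \<times> nat) set list \<Rightarrow> nat list \<Rightarrow> nat \<times> nat \<Rightarrow> nat" where
  "combine_values D Ds ms = (\<lambda>c\<in>D. ms ! (decomposition_tableau Ds c - 1))"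

lemma combine_values_eq:
  assumes "Ds \<in> SSD D" "i < length Ds" "c \<in> Ds ! i"
  shows "combine_values D Ds ms c = ms ! i"
proof -
  have "c \<in> D" using assms nth_mem[OF assms(2)] by (auto simp: SSD_def)
  then show ?thesis using decomposition_tableau_eq[OF assms] by (simp add: combine_values_def)
qed

text \<open>Replacing the labels by the entries of a strictly increasing sequence preserves both
  strict and weak inequalities.\<close>

lemma combine_values_semi_standard:
  assumes Ds: "Ds \<in> SSD D" and ms: "ms \<in> increasing_seqs (length Ds)"
  shows "combine_values D Ds ms \<in> tableaux D" "semi_standard D (combine_values D Ds ms)"
proof -
  have len: "length ms = length Ds" and sorted: "sorted_wrt (<) ms" "sorted ms"
    and pos: "\<forall>m\<in>set ms. 0 < m"
    using ms by (auto simp: increasing_seqs_def strict_sorted_iff)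
  have "1 \<le> combine_values D Ds ms c" if c: "c \<in> D" for c
  proof -
    obtain i where "i < length Ds" "c \<in> Ds ! i" using SSD_obtain_block[OF Ds c] by metis
    then show ?thesis using combine_values_eq[OF Ds] pos len by (simp add: Suc_le_eq)
  qed
  then show "combine_values D Ds ms \<in> tableaux D"
    by (auto simp: tableaux_def combine_values_def)
  have less: "combine_values D Ds ms c < combine_values D Ds ms c'"
    if c: "c \<in> D" "c' \<in> D" "decomposition_tableau Ds c < decomposition_tableau Ds c'" for c c'
  proof -
    obtain i where i: "i < length Ds" "c \<in> Ds ! i" "decomposition_tableau Ds c = Suc i"
      using SSD_obtain_block[OF Ds c(1)] .
    obtain j where j: "j < length Ds" "c' \<in> Ds ! j" "decomposition_tableau Ds c' = Suc j"
      using SSD_obtain_block[OF Ds c(2)] .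
    show ?thesis
      using i j c len combine_values_eq[OF Ds i(1,2)] combine_values_eq[OF Ds j(1,2)]
        sorted_wrt_nth_less[OF sorted(1), of i j] by simp
  qed
  have le: "combine_values D Ds ms c \<le> combine_values D Ds ms c'"
    if "c \<in> D" "c' \<in> D" "decomposition_tableau Ds c \<le> decomposition_tableau Ds c'" for c c'
  proof (cases "decomposition_tableau Ds c < decomposition_tableau Ds c'")
    case True
    then show ?thesis using less[OF that(1,2)] by simp
  next
    case False
    then show ?thesis using that by (simp add: combine_values_def)
  qed
  have "semi_standard D (decomposition_tableau Ds)" using Ds by (simp add: SSD_def)
  then show "semi_standard D (combine_values D Ds ms)"
    unfolding semi_standard_def using less le by blast
qed

text \<open>The blocks are listed by increasing value, so that their labels compare in the same way
  as the entries of \<open>m\<close>.\<close>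

definition level_sets :: "(nat \<times> nat) set \<Rightarrow> (nat \<times> nat \<Rightarrow> nat) \<Rightarrow> (nat \<times> nat) set list" where
  "level_sets D m = map (\<lambda>v. {c \<in> D. m c = v}) (sorted_list_of_set (m ` D))"

text \<open>The entries of \<open>ms\<close> are distinct, which keeps the blocks apart, and the
  blocks are non-empty, so every entry occurs; hence both components can be recovered.\<close>

lemma level_sets_combine_values:
  assumes Ds: "Ds \<in> SSD D" and ms: "ms \<in> increasing_seqs (length Ds)"
  shows "sorted_list_of_set (combine_values D Ds ms ` D) = ms"
    and "level_sets D (combine_values D Ds ms) = Ds"
proof -
  let ?m = "combine_values D Ds ms"
  have len: "length ms = length Ds" and sorted: "sorted ms" "distinct ms"
    using ms by (auto simp: increasing_seqs_def strict_sorted_iff)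
  have ne: "\<forall>E\<in>set Ds. E \<noteq> {}" and U: "\<Union>(set Ds) = D" using Ds by (simp_all add: SSD_def)
  have block: "{c \<in> D. ?m c = ms ! i} = Ds ! i" if i: "i < length Ds" for i
  proof (intro equalityI subsetI)
    fix c assume c: "c \<in> {c \<in> D. ?m c = ms ! i}"
    then obtain j where j: "j < length Ds" "c \<in> Ds ! j" using SSD_obtain_block[OF Ds] by blast
    then have "ms ! j = ms ! i" using c combine_values_eq[OF Ds j] by simp
    then have "j = i" using sorted(2) i j len by (simp add: nth_eq_iff_index_eq)
    then show "c \<in> Ds ! i" using j by simp
  next
    fix c assume c: "c \<in> Ds ! i"
    then have "c \<in> D" using nth_mem[OF i] U by blast
    then show "c \<in> {c \<in> D. ?m c = ms ! i}" using combine_values_eq[OF Ds i c] by simp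
  qed
  have "?m ` D = set ms"
  proof (intro equalityI subsetI)
    fix v assume "v \<in> ?m ` D"
    then obtain c where c: "c \<in> D" "v = ?m c" by blast
    obtain j where j: "j < length Ds" "c \<in> Ds ! j" using SSD_obtain_block[OF Ds c(1)] by blast
    then show "v \<in> set ms" using c combine_values_eq[OF Ds j] len by simp
  next
    fix v assume "v \<in> set ms"
    then obtain i where i: "i < length Ds" "v = ms ! i" using len by (metis in_set_conv_nth)
    then obtain c where "c \<in> Ds ! i" using ne nth_mem[OF i(1)] by blast
    then have "c \<in> D \<and> ?m c = v" using block[OF i(1)] i by blast
    then show "v \<in> ?m ` D" by blast
  qed
  then show vals: "sorted_list_of_set (?m ` D) = ms"
    using sorted by (simp add: sorted_list_of_set.idem_if_sorted_distinct)
  show "level_sets D ?m = Ds"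
    unfolding level_sets_def vals using len block by (intro nth_equalityI) auto
qed

text \<open>The label of a cell is the position, counted from 1, of its entry in the strictly
  increasing list \<open>vs\<close>. Labels therefore compare as the entries do, and
  semi-standardness carries over.\<close>

lemma level_sets_SSD:
  assumes "finite D" "m \<in> tableaux D" "semi_standard D m"
  defines "vs \<equiv> sorted_list_of_set (m ` D)"
  shows "level_sets D m \<in> SSD D" "vs \<in> increasing_seqs (length (level_sets D m))"
    "combine_values D (level_sets D m) vs = m"
proof -
  let ?Ds = "level_sets D m"
  have set_vs: "set vs = m ` D" and sorted: "sorted_wrt (<) vs" "sorted vs" "distinct vs"
    using assms(1) by (simp_all add: vs_def)
  have len: "length ?Ds = length vs" by (simp add: level_sets_def vs_def)
  have nth: "?Ds ! i = {c \<in> D. m c = vs ! i}" if "i < length vs" for i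
    using that by (simp add: level_sets_def vs_def)
  have disj: "disjoint_family_on (\<lambda>a. ?Ds ! (a - 1)) {1..length ?Ds}"
    unfolding disjoint_family_on_def
  proof (intro ballI impI)
    fix a a' assume a: "a \<in> {1..length ?Ds}" "a' \<in> {1..length ?Ds}" "a \<noteq> a'"
    then have lt: "a - 1 < length vs" "a' - 1 < length vs" and "a - 1 \<noteq> a' - 1"
      using len by auto
    then have "vs ! (a - 1) \<noteq> vs ! (a' - 1)"
      using nth_eq_iff_index_eq[OF sorted(3) lt] by simp
    then show "?Ds ! (a - 1) \<inter> ?Ds ! (a' - 1) = {}" using lt by (auto simp: nth)
  qed
  have block: "\<exists>i<length vs. m c = vs ! i \<and> decomposition_tableau ?Ds c = Suc i" if "c \<in> D" for c
  proof -
    have "m c \<in> set vs" using that set_vs by simp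
    then obtain i where i: "i < length vs" "m c = vs ! i" by (metis in_set_conv_nth)
    then have "decomposition_tableau ?Ds c = Suc i"
      using that by (intro decomposition_tableau_disjoint[OF disj]) (auto simp: nth len)
    then show ?thesis using i by blast
  qed
  have less: "decomposition_tableau ?Ds c < decomposition_tableau ?Ds c'"
    if c: "c \<in> D" "c' \<in> D" "m c < m c'" for c c'
  proof -
    obtain i where i: "i < length vs" "m c = vs ! i" "decomposition_tableau ?Ds c = Suc i"
      using block[OF c(1)] by blast
    obtain j where j: "j < length vs" "m c' = vs ! j" "decomposition_tableau ?Ds c' = Suc j"
      using block[OF c(2)] by blast
    have "\<not> j \<le> i" using sorted_nth_mono[OF sorted(2), of j i] i(1,2) j(2) c(3) by linarith
    then show ?thesis using i j by simp
  qed
  have le: "decomposition_tableau ?Ds c \<le> decomposition_tableau ?Ds c'"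
    if c: "c \<in> D" "c' \<in> D" "m c \<le> m c'" for c c'
  proof -
    obtain i where i: "i < length vs" "m c = vs ! i" "decomposition_tableau ?Ds c = Suc i"
      using block[OF c(1)] by blast
    obtain j where j: "j < length vs" "m c' = vs ! j" "decomposition_tableau ?Ds c' = Suc j"
      using block[OF c(2)] by blast
    have "\<not> j < i" using sorted_wrt_nth_less[OF sorted(1), of j i] i(1,2) j(2) c(3) by linarith
    then show ?thesis using i j by simp
  qed
  have "semi_standard D (decomposition_tableau ?Ds)"
    using assms(3) by (auto simp: semi_standard_def intro: less le)
  moreover have "\<forall>E\<in>set ?Ds. E \<noteq> {}" "\<Union>(set ?Ds) = D"
    using assms(1) by (auto simp: level_sets_def)
  ultimately show "?Ds \<in> SSD D" using disj by (simp add: SSD_def)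
  have "0 < v" if v: "v \<in> set vs" for v
  proof -
    obtain c where "c \<in> D" "v = m c" using v set_vs by blast
    then show ?thesis using PiE_mem[OF assms(2)[unfolded tableaux_def]] by fastforce
  qed
  then show "vs \<in> increasing_seqs (length ?Ds)"
    using sorted by (simp add: increasing_seqs_def len)
  show "combine_values D ?Ds vs = m"
  proof
    fix c show "combine_values D ?Ds vs c = m c"
    proof (cases "c \<in> D")
      case True
      then show ?thesis using block[OF True] by (auto simp: combine_values_def)
    next
      \<comment> \<open>Outside \<open>D\<close> both sides have the default value of extensional
        functions.\<close>
      case False
      then show ?thesis using PiE_arb[OF assms(2)[unfolded tableaux_def] False] by (simp add: combine_values_def)
    qed
  qed
qed

text \<open>This reindexing turns the series of \<open>schur_mzv\<close> into a double sum over
  decompositions and increasing sequences.\<close>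

lemma bij_betw_combine_values:
  assumes "finite D"
  shows "bij_betw (\<lambda>(Ds, ms). combine_values D Ds ms) (SIGMA Ds:SSD D. increasing_seqs (length Ds))
    {m \<in> tableaux D. semi_standard D m}"
  by (rule bij_betw_byWitness[where f' = "\<lambda>m. (level_sets D m, sorted_list_of_set (m ` D))"])
    (auto simp: level_sets_combine_values level_sets_SSD[OF assms] combine_values_semi_standard)

section \<open>The identity\<close>

lemma Q_map_single: "Q_map l (Poly_Mapping.single u 1) = Q_word l (indices u)"
  by (simp add: Q_map_def)

text \<open>Cancellation can make the keys of a sum smaller than the union of the keys, so
  additivity is proved over a common larger index set.\<close>

lemma Q_map_eq_sum_superset:
  assumes "finite A" "Poly_Mapping.keys p \<subseteq> A"
  shows "Q_map l p = (\<Sum>u\<in>A. of_rat (Poly_Mapping.lookup p u) * Q_word l (indices u))"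
  unfolding Q_map_def using assms by (intro sum.mono_neutral_left) (auto simp: in_keys_iff)

lemma Q_map_add: "Q_map l (p + q) = Q_map l p + Q_map l q"
proof -
  let ?A = "Poly_Mapping.keys p \<union> Poly_Mapping.keys q"
  have "finite ?A" by simp
  from Q_map_eq_sum_superset[OF this] show ?thesis
    using keys_add[of p q] by (simp add: lookup_add of_rat_add sum.distrib distrib_right)
qed

lemma Q_map_sum: "Q_map l (sum p A) = (\<Sum>x\<in>A. Q_map l (p x))"
proof (induction A rule: infinite_finite_induct)
  case (insert x A)
  then show ?case by (simp add: Q_map_add)
qed (simp_all add: Q_map_def)

text \<open>Multiplying monomials concatenates their words. Positivity of the entries ensures that
  \<open>Word\<close> is inverted by \<open>indices\<close>.\<close>

lemma prod_list_gen_z: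
  assumes "\<And>k. k \<in> set ks \<Longrightarrow> 1 \<le> k"
  shows "prod_list (map gen_z ks) = Poly_Mapping.single (Word ks) 1"
  using assms
proof (induction ks)
  case Nil
  have "Word [] = 0" by (simp add: zero_zword_def)
  then show ?case by simp
next
  case (Cons k ks)
  have "Word [k] + Word ks = Word (k # ks)"
    using Cons.prems by (simp add: indices_inject[symmetric] plus_zword.rep_eq Word_inverse)
  then show ?case using Cons by (simp add: gen_z_def mult_single)
qed

text \<open>Different decompositions may give the same word; linearity avoids collecting
  coefficients. Non-empty blocks make each word valid.\<close>

lemma Q_map_\<phi>:
  assumes "finite (diagram la mu)"
  shows "Q_map l (\<phi> la mu) = (\<Sum>Ds\<in>SSD (diagram la mu). Q_word l (map card Ds))"
proof -
  have "Q_map l (prod_list (map (\<lambda>E. gen_z (card E)) Ds)) = Q_word l (map card Ds)"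
    if "Ds \<in> SSD (diagram la mu)" for Ds
  proof -
    have pos: "1 \<le> k" if k: "k \<in> set (map card Ds)" for k
    proof -
      obtain E where E: "E \<in> set Ds" "k = card E" using k by auto
      then have "E \<noteq> {}" "finite E"
        using \<open>Ds \<in> SSD _\<close> assms by (auto simp: SSD_def intro: finite_subset)
      then show ?thesis using E by (simp add: Suc_le_eq card_gt_0_iff)
    qed
    then have "prod_list (map (\<lambda>E. gen_z (card E)) Ds) = Poly_Mapping.single (Word (map card Ds)) 1"
      using prod_list_gen_z[of "map card Ds"] by (simp add: comp_def)
    then show ?thesis using pos by (simp add: Q_map_single Word_inverse)
  qed
  then show ?thesis by (simp add: \<phi>_def Q_map_sum)
qed

text \<open>The lower bounds add up to \<open>card E\<close>, plus one if \<open>c0\<close> lies in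
  \<open>E\<close>; this produces the shifts \<open>n - 1\<close> and \<open>n - 2\<close> of
  \<open>Q_word\<close>. If the guard holds but \<open>n\<close> is below that total, the binomial
  coefficient vanishes by itself.\<close>

lemma card_corner_fillings:
  assumes "finite E" "E \<noteq> {}"
  shows "card (bounded_fillings (\<lambda>c. if c = c0 then 2 else 1) E n) =
    (if c0 \<in> E then (if 2 \<le> n then (n - 2) choose (card E - 1) else 0)
     else (if 1 \<le> n then (n - 1) choose (card E - 1) else 0))"
proof -
  have "(\<Sum>c\<in>E. if c = c0 then 2 else 1 :: nat) = (\<Sum>c\<in>E. 1 + (if c = c0 then 1 else 0))"
    by (intro sum.cong) auto
  also have "\<dots> = card E + (if c0 \<in> E then 1 else 0)"
    by (subst sum.distrib) (simp add: assms(1))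
  finally have sum: "(\<Sum>c\<in>E. if c = c0 then 2 else 1 :: nat) = card E + (if c0 \<in> E then 1 else 0)" .
  have "card E > 0" using assms by (simp add: card_gt_0_iff)
  then show ?thesis
    unfolding card_bounded_fillings[OF assms] sum by (auto simp: binomial_eq_0 numeral_2_eq_2)
qed

text \<open>The binomial coefficients of \<open>Q_word\<close> count the fillings of the blocks; the
  exceptional last factor belongs to the block containing the corner.\<close>

lemma Q_word_card_blocks:
  assumes "finite D" "corners D = {c0}" and Ds: "Ds \<in> SSD D"
  defines "b \<equiv> \<lambda>c. if c = c0 then 2 else 1"
  shows "Q_word l (map card Ds) = (\<Sum>ws | length ws = length Ds \<and> sum_list ws = card D + l.
    (\<Prod>i<length Ds. real (card (bounded_fillings b (Ds ! i) (ws ! i)))) * mzv ws)"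
proof -
  let ?r = "length Ds"
  let ?N = "\<lambda>i n. card (bounded_fillings b (Ds ! i) n)"
  let ?T = "{ws :: nat list. length ws = ?r \<and> sum_list ws = card D + l}"
  let ?A = "{ws \<in> ?T. (\<forall>i<?r - 1. 1 \<le> ws ! i) \<and> 2 \<le> ws ! (?r - 1)}"
  note last = corner_in_last_block[OF assms(1-3)]
  have U: "\<Union>(set Ds) = D" and ne: "\<forall>E\<in>set Ds. E \<noteq> {}" using Ds by (simp_all add: SSD_def)
  have block: "finite (Ds ! i)" "Ds ! i \<noteq> {}" if "i < ?r" for i
    using nth_mem[OF that] U ne assms(1) by (auto intro: finite_subset)
  have r: "?r = Suc (?r - 1)" using last(1) by simp
  have "c0 \<notin> Ds ! i" if "i < ?r - 1" for i
    using SSD_blocks_disjoint[OF Ds, of i "?r - 1"] last that by auto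
  then have N: "?N i n = (if 1 \<le> n then (n - 1) choose (card (Ds ! i) - 1) else 0)" if "i < ?r - 1" for i n
    using that block[of i] by (simp add: b_def card_corner_fillings)
  have N_last: "?N (?r - 1) n = (if 2 \<le> n then (n - 2) choose (card (Ds ! (?r - 1)) - 1) else 0)" for n
    using last block[of "?r - 1"] by (simp add: b_def card_corner_fillings)
  have split: "(\<Prod>i<?r. real (?N i (ws ! i))) =
      (\<Prod>i<?r - 1. real (?N i (ws ! i))) * real (?N (?r - 1) (ws ! (?r - 1)))" for ws
    by (subst (1) r) simp
  \<comment> \<open>Cardinalities are written as sums of ones, so that
    \<open>sum_Union_blocks\<close> applies to the partition of \<open>D\<close>.\<close>
  have "sum_list (map card Ds) = sum_list (map (sum (\<lambda>_. 1)) Ds)"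
    by (rule arg_cong[where f = sum_list]) simp
  also have "\<dots> = sum (\<lambda>_. 1) D"
    using sum_Union_blocks[of Ds "\<lambda>_. 1"] SSD_blocks_disjoint[OF Ds] U assms(1) by simp
  finally have "sum_list (map card Ds) = card D" by simp
  then have "Q_word l (map card Ds) = (\<Sum>ws\<in>?A. (\<Prod>i<?r. real (?N i (ws ! i))) * mzv ws)"
    using last(1) unfolding Q_word_def Let_def split
    by (auto intro!: sum.cong prod.cong simp: N N_last simp del: One_nat_def)
  \<comment> \<open>The added \<open>ws\<close> leave some block without a filling, so their
    coefficient vanishes whatever \<open>mzv ws\<close> is.\<close>
  also have "\<dots> = (\<Sum>ws\<in>?T. (\<Prod>i<?r. real (?N i (ws ! i))) * mzv ws)"
  proof (rule sum.mono_neutral_left)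
    show "finite ?T"
      by (rule finite_lists_sum_eq)
    show "\<forall>ws\<in>?T - ?A. (\<Prod>i<?r. real (?N i (ws ! i))) * mzv ws = 0"
    proof
      fix ws assume "ws \<in> ?T - ?A"
      then have "(\<exists>i<?r - 1. \<not> 1 \<le> ws ! i) \<or> \<not> 2 \<le> ws ! (?r - 1)" by auto
      then have "(\<Prod>i<?r. real (?N i (ws ! i))) = 0"
        unfolding split using N N_last by (auto simp: prod_zero_iff)
      then show "(\<Prod>i<?r. real (?N i (ws ! i))) * mzv ws = 0" by simp
    qed
  qed auto
  finally show ?thesis .
qed

section \<open>Interchange of the sums\<close>

lemma has_sum_sum:
  fixes f :: "'a \<Rightarrow> 'b \<Rightarrow> real"
  assumes "finite A" "\<And>a. a \<in> A \<Longrightarrow> (f a has_sum s a) B"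
  shows "((\<lambda>x. \<Sum>a\<in>A. f a x) has_sum (\<Sum>a\<in>A. s a)) B"
  using assms by (induction A rule: finite_induct) (auto intro!: has_sum_add has_sum_0)

text \<open>The entry at \<open>c0\<close> is maximal and has exponent at least 2, which gives
  absolute convergence and permits splitting the series by decompositions. The second claim is a
  slice of the same summable family.\<close>

lemma schur_mzv_eq_sum_SSD:
  assumes "finite D" "corners D = {c0}"
    and k: "\<And>c. c \<in> D \<Longrightarrow> 1 \<le> k c" "2 \<le> k c0"
  shows "schur_mzv D k = (\<Sum>Ds\<in>SSD D. \<Sum>\<^sub>\<infinity>ms\<in>increasing_seqs (length Ds).
      \<Prod>i<length Ds. 1 / real (ms ! i) ^ sum k (Ds ! i))"
    and "Ds \<in> SSD D \<Longrightarrow> (\<lambda>ms. \<Prod>i<length Ds. 1 / real (ms ! i) ^ sum k (Ds ! i))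
      summable_on increasing_seqs (length Ds)"
proof -
  let ?M = "{m \<in> tableaux D. semi_standard D m}"
  let ?S = "SIGMA Ds:SSD D. increasing_seqs (length Ds)"
  let ?t = "\<lambda>m. \<Prod>c\<in>D. 1 / real (m c) ^ k c"
  let ?u = "\<lambda>Ds ms. \<Prod>i<length Ds. 1 / real (ms ! i) ^ sum k (Ds ! i)"
  note bij = bij_betw_combine_values[OF assms(1)]
  have "c0 \<in> corners D" using assms(2) by simp
  then have c0: "c0 \<in> D" by (auto simp: corners_def)
  have t: "?t summable_on ?M"
  proof (rule dominated_product_summable[where k = k, OF assms(1) c0 k])
    show "?M \<subseteq> D \<rightarrow>\<^sub>E {1..}" by (auto simp only: tableaux_def)
    show "m c \<le> m c0" if "m \<in> ?M" "c \<in> D" for m c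
      using semi_standard_le_corner[OF assms(1,2)] that by blast
  qed
  have eq: "?t (combine_values D Ds ms) = ?u Ds ms" if Ds: "Ds \<in> SSD D" for Ds ms
  proof -
    have U: "D = (\<Union>i<length Ds. Ds ! i)" using Ds by (auto simp: SSD_def set_conv_nth)
    have fin: "finite (Ds ! i)" if "i < length Ds" for i
      using U assms(1) that by (auto intro: finite_subset)
    have "prod g D = (\<Prod>i<length Ds. \<Prod>c\<in>Ds ! i. g c)" for g :: "nat \<times> nat \<Rightarrow> real"
    proof -
      have "prod g (\<Union>i<length Ds. Ds ! i) = (\<Prod>i<length Ds. \<Prod>c\<in>Ds ! i. g c)"
        using fin SSD_blocks_disjoint[OF Ds] by (intro prod.UNION_disjoint) auto
      then show ?thesis by (simp only: U[symmetric])
    qed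
    then have "?t (combine_values D Ds ms) =
        (\<Prod>i<length Ds. \<Prod>c\<in>Ds ! i. 1 / real (combine_values D Ds ms c) ^ k c)" .
    \<comment> \<open>Entries are constant on each block, so the exponents within a block add
      up.\<close>
    also have "\<dots> = ?u Ds ms"
      by (intro prod.cong)
        (auto simp: combine_values_eq[OF Ds] power_sum prod_dividef intro!: prod.cong)
    finally show ?thesis .
  qed
  have S: "(\<lambda>(Ds, ms). ?u Ds ms) summable_on ?S"
    using t unfolding summable_on_reindex_bij_betw[OF bij, symmetric]
    by (rule summable_on_cong[THEN iffD1, rotated]) (auto simp: eq)
  show "?u Ds summable_on increasing_seqs (length Ds)" if "Ds \<in> SSD D"
    using summable_on_SigmaD1[OF S that] by simp
  have "schur_mzv D k = infsum (\<lambda>(Ds, ms). ?u Ds ms) ?S"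
    unfolding schur_mzv_def infsum_reindex_bij_betw[OF bij, symmetric]
    by (intro infsum_cong) (auto simp: eq)
  also have "\<dots> = (\<Sum>\<^sub>\<infinity>Ds\<in>SSD D. infsum (?u Ds) (increasing_seqs (length Ds)))"
    using infsum_Sigma'_banach[OF S] by simp
  finally show "schur_mzv D k = (\<Sum>Ds\<in>SSD D. infsum (?u Ds) (increasing_seqs (length Ds)))"
    by (simp add: finite_SSD[OF assms(1)])
qed

text \<open>For each decomposition the finite sum over fillings moves inside the series in
  \<open>ms\<close>. Grouping by block sums evaluates that same series a second time, and uniqueness
  of its value gives the equality.\<close>

lemma sum_schur_mzv_eq_Q_word:
  assumes "finite D" "corners D = {c0}"
  shows "(\<Sum>k | k \<in> tableaux D \<and> admissible D k \<and> weight D k = card D + l. schur_mzv D k) =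
    (\<Sum>Ds\<in>SSD D. Q_word l (map card Ds))"
proof -
  define b where "b = (\<lambda>c. if c = c0 then 2 else 1 :: nat)"
  define K where "K = bounded_fillings b D (card D + l)"
  define u :: "(nat \<times> nat) set list \<Rightarrow> _"
    where "u = (\<lambda>Ds ks ms. \<Prod>i<length Ds. 1 / real (ms ! i) ^ (ks i :: nat))"
  have "c0 \<in> corners D" using assms(2) by simp
  then have c0: "c0 \<in> D" by (auto simp: corners_def)
  have b: "(\<forall>c\<in>D. b c \<le> k c) \<longleftrightarrow> (\<forall>c\<in>D. 1 \<le> k c) \<and> 2 \<le> k c0" for k
  proof
    assume *: "\<forall>c\<in>D. b c \<le> k c"
    have "1 \<le> k c" if "c \<in> D" for c
    proof -
      have "1 \<le> b c" by (simp add: b_def)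
      also have "b c \<le> k c" using * that by blast
      finally show ?thesis .
    qed
    moreover have "b c0 \<le> k c0" using * c0 by blast
    ultimately show "(\<forall>c\<in>D. 1 \<le> k c) \<and> 2 \<le> k c0" by (simp add: b_def)
  qed (simp add: b_def)
  \<comment> \<open>As \<open>c0\<close> is the only corner, positivity and admissibility together
    are the lower bound \<open>b\<close>.\<close>
  have K: "{k. k \<in> tableaux D \<and> admissible D k \<and> weight D k = card D + l} = K"
    unfolding K_def bounded_fillings_def b tableaux_def admissible_def weight_def assms(2) PiE_iff
    by auto
  have finK: "finite K" using assms(1) by (simp add: K_def finite_bounded_fillings)
  have adm: "\<And>c. c \<in> D \<Longrightarrow> 1 \<le> k c" "2 \<le> k c0" if "k \<in> K" for k
    using that unfolding K_def bounded_fillings_def b by auto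
  have "(\<Sum>k\<in>K. schur_mzv D k) =
      (\<Sum>k\<in>K. \<Sum>Ds\<in>SSD D. infsum (u Ds (\<lambda>i. sum k (Ds ! i))) (increasing_seqs (length Ds)))"
    unfolding u_def by (intro sum.cong refl schur_mzv_eq_sum_SSD(1)[OF assms] adm)
  also have "\<dots> = (\<Sum>Ds\<in>SSD D. \<Sum>k\<in>K. infsum (u Ds (\<lambda>i. sum k (Ds ! i))) (increasing_seqs (length Ds)))"
    by (rule sum.swap)
  also have "\<dots> = (\<Sum>Ds\<in>SSD D. Q_word l (map card Ds))"
  proof (rule sum.cong[OF refl])
    fix Ds assume Ds: "Ds \<in> SSD D"
    let ?A = "increasing_seqs (length Ds)"
    let ?T = "{ws :: nat list. length ws = length Ds \<and> sum_list ws = card D + l}"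
    let ?N = "\<lambda>ws. \<Prod>i<length Ds. real (card (bounded_fillings b (Ds ! i) (ws ! i)))"
    have U: "\<Union>(set Ds) = D" using Ds by (simp add: SSD_def)
    have finT: "finite ?T"
      by (rule finite_lists_sum_eq)
    have "((\<lambda>ms. \<Sum>k\<in>K. u Ds (\<lambda>i. sum k (Ds ! i)) ms) has_sum
        (\<Sum>k\<in>K. infsum (u Ds (\<lambda>i. sum k (Ds ! i))) ?A)) ?A"
    proof (intro has_sum_sum finK has_sum_infsum)
      fix k assume "k \<in> K"
      then show "u Ds (\<lambda>i. sum k (Ds ! i)) summable_on ?A"
        unfolding u_def by (intro schur_mzv_eq_sum_SSD(2)[OF assms] adm Ds)
    qed
    moreover have "(\<Sum>k\<in>K. u Ds (\<lambda>i. sum k (Ds ! i)) ms) = (\<Sum>ws\<in>?T. ?N ws * u Ds ((!) ws) ms)" for ms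
      using sum_bounded_fillings_blocks[of Ds "\<lambda>i n. 1 / real (ms ! i) ^ n" b "card D + l"]
        SSD_blocks_disjoint[OF Ds] U assms(1) by (simp add: u_def K_def)
    ultimately have "((\<lambda>ms. \<Sum>ws\<in>?T. ?N ws * u Ds ((!) ws) ms) has_sum
        (\<Sum>k\<in>K. infsum (u Ds (\<lambda>i. sum k (Ds ! i))) ?A)) ?A"
      by simp
    moreover have "((\<lambda>ms. \<Sum>ws\<in>?T. ?N ws * u Ds ((!) ws) ms) has_sum (\<Sum>ws\<in>?T. ?N ws * mzv ws)) ?A"
    proof (rule has_sum_sum[OF finT])
      fix ws assume ws: "ws \<in> ?T"
      show "((\<lambda>ms. ?N ws * u Ds ((!) ws) ms) has_sum ?N ws * mzv ws) ?A"
      \<comment> \<open>With coefficient 0 the series for \<open>ws\<close> may diverge, so this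
        case is separate. Otherwise every block has a filling, which forces positive exponents and a
        last exponent of at least 2.\<close>
      proof (cases "?N ws = 0")
        case True
        show ?thesis unfolding True mult_zero_left by (rule has_sum_0) simp
      next
        case False
        have nz: "card (bounded_fillings b (Ds ! i) (ws ! i)) \<noteq> 0" if "i < length Ds" for i
          using False that by (auto simp: prod_zero_iff)
        have block: "finite (Ds ! i)" "Ds ! i \<noteq> {}" if "i < length Ds" for i
          using nth_mem[OF that] Ds assms(1) by (auto simp: SSD_def intro: finite_subset)
        note last = corner_in_last_block[OF assms Ds]
        have "1 \<le> ws ! i" if "i < length ws" for i
          using nz[of i] card_corner_fillings[OF block, of i c0 "ws ! i"] that ws
          by (auto simp: b_def split: if_splits)
        moreover have "2 \<le> ws ! (length ws - 1)"
          using nz[of "length ws - 1"] last ws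
            card_corner_fillings[OF block, of "length ws - 1" c0 "ws ! (length ws - 1)"]
          by (auto simp: b_def split: if_splits)
        moreover have "ws \<noteq> []" using last ws by auto
        ultimately have "u Ds ((!) ws) summable_on ?A"
          using mzv_summable[of ws] ws by (simp add: u_def)
        moreover have "mzv ws = infsum (u Ds ((!) ws)) ?A"
          using ws by (simp add: mzv_def u_def increasing_seqs_def)
        ultimately show ?thesis by (simp add: has_sum_cmult_right)
      qed
    qed
    ultimately show "(\<Sum>k\<in>K. infsum (u Ds (\<lambda>i. sum k (Ds ! i))) ?A) = Q_word l (map card Ds)"
      unfolding Q_word_card_blocks[OF assms Ds] b_def[symmetric] by (rule has_sum_unique)
  qed
  finally show ?thesis unfolding K .
qed

lemma finite_diagram: "finite (diagram la mu)"
  by (rule finite_subset[of _ "SIGMA i:{1..length la}. {..part la i}"]) (auto simp: diagram_def)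

theorem theorem4p2:
  fixes la mu :: "nat list" and w :: nat
  assumes "skew_shape la mu"
    and "card (corners (diagram la mu)) = 1"
    and "w > card (diagram la mu)"
  shows "schur_sum w la mu = Q_map (w - card (diagram la mu)) (\<phi> la mu)"
proof -
  obtain c0 where "corners (diagram la mu) = {c0}"
    using assms(2) by (auto simp: card_1_singleton_iff)
  \<comment> \<open>Since \<open>w\<close> exceeds the size of the diagram, the subtraction is exact
    and the weight \<open>card D + l\<close> is \<open>w\<close>.\<close>
  from sum_schur_mzv_eq_Q_word[OF finite_diagram this, of "w - card (diagram la mu)"]
  show ?thesis
    using assms(3) by (simp add: schur_sum_def Let_def Q_map_\<phi>[OF finite_diagram])
qed

end
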